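(* Consider the iterates generated by the Augmented Lagrangian algorithm described in the context. Let $\delta>0$, $\varepsilon>0$ and $\rho_{\mathrm{big}}>\rho_1$ be given. Assume that $N(\varepsilon)\in\{1,2,3,\dots\}$ is such that $\varepsilon_k\le\varepsilon$ for all $k\ge N(\varepsilon)$. Assume in addition that there exist $c_{\mathrm{inner}}>0$ and $q>0$, where $c_{\mathrm{inner}}$ only depends on $\rho_{\mathrm{big}}$, $\lambda_{\min}$, $\lambda_{\max}$, $\mu_{\max}$, $\ell$, $u$ and characteristics of the functions $f$, $h$ and $g$, such that the number of inner iterations, function and derivative evaluations that are necessary to obtain, at Step 1 of iteration $k$, a point $x^k\in[\ell,u]$ satisfying $\|P_{[\ell,u]}(x^k-\nabla L_{\rho_k}(x^k,\bar\lambda^k,\bar\mu^k))-x^k\|\le\varepsilon_k$ is bounded above by $c_{\mathrm{inner}}\,\varepsilon_k^{-q}$. Then the number of inner iterations, function evaluations and derivative evaluations that are necessary to obtain $k$ such that $$\left\|P_{[\ell,u]}\left(x^k-\left(\nabla f(x^k)+\nabla h(x^k)\lambda^{k+1}+\nabla g(x^k)\mu^{k+1}\right)\right)-x^k\right\|\le\varepsilon,$$ $$\|h(x^k)\|_\infty\le\delta,\qquad\|g(x^k)_+\|_\infty\le\delta,$$ and, for all $j=1,\dots,p$, $\mu_j^{k+1}=0$ whenever $g_j(x^k)<-\delta$, all hold, or such that $\rho_k>\rho_{\mathrm{big}}$, is bounded above by $$c_{\mathrm{inner}}\,\varepsilon_{\min,2}^{-q}\left\{N(\varepsilon)+\left[\frac{\log(\rho_{\mathrm{big}}/\rho_1)}{\log(\gamma)}\right]\times\left[\frac{\log(\delta/c_{\mathrm{big}})}{\log(\tau)}\right]\right\},$$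 where $$\varepsilon_{\min,2}=\min\left\{\varepsilon_k\;\middle|\;k\le N(\varepsilon)+\left[\frac{\log(\rho_{\mathrm{big}}/\rho_1)}{\log(\gamma)}\right]\times\left[\frac{\log(\delta/c_{\mathrm{big}})}{\log(\tau)}\right]\right\}.$$
   Context: Problem: minimize $f(x)$ subject to $h(x)=0$, $g(x)\le 0$, $\ell\le x\le u$, where $f:\mathbb{R}^n\to\mathbb{R}$, $h:\mathbb{R}^n\to\mathbb{R}^m$, $g:\mathbb{R}^n\to\mathbb{R}^p$ are continuously differentiable and $\ell,u\in\mathbb{R}^n$. Notation: $[\ell,u]=\{x\in\mathbb{R}^n: \ell\le x\le u\}$; $P_C$ is the Euclidean projection onto a convex set $C$; $\|\cdot\|$ is the Euclidean norm; $v_+$ is the vector with components $\max\{0,v_i\}$; the min of two vectors is componentwise; $\nabla h(x)$, $\nabla g(x)$ are the matrices whose columns are the gradients of the components of $h$, $g$. Augmented Lagrangian: for $x\in[\ell,u]$, $\rho>0$, $\lambda\in\mathbb{R}^m$, $\mu\in\mathbb{R}^p_+$, $$L_\rho(x,\lambda,\mu)=f(x)+\frac{\rho}{2}\left[\sum_{i=1}^m\left(h_i(x)+\frac{\lambda_i}{\rho}\right)^2+\sum_{i=1}^p\left(g_i(x)+\frac{\mu_i}{\rho}\right)_+^2\right],$$ and $\nabla L_\rho$ is its gradient with respect to $x$. Algorithm: given $x^0\in\mathbb{R}^n$, $\lambda_{\min}<\lambda_{\max}$, $\bar\lambda^1\in[\lambda_{\min},\lambda_{\max}]^m$, $\mu_{\max}>0$,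 $\bar\mu^1\in[0,\mu_{\max}]^p$, $\rho_1>0$, $\gamma>1$, $0<\tau<1$ and a sequence of positive tolerances $\{\varepsilon_k\}_{k\ge1}$, for $k=1,2,\dots$: Step 1: find $x^k\in[\ell,u]$ with $\|P_{[\ell,u]}(x^k-\nabla L_{\rho_k}(x^k,\bar\lambda^k,\bar\mu^k))-x^k\|\le\varepsilon_k$. Step 2: set $V^k=\min\{-g(x^k),\bar\mu^k/\rho_k\}$. If $k=1$ or $\max\{\|h(x^k)\|,\|V^k\|\}\le\tau\max\{\|h(x^{k-1})\|,\|V^{k-1}\|\}$, set $\rho_{k+1}=\rho_k$; otherwise set $\rho_{k+1}=\gamma\rho_k$. Step 3: set $\lambda^{k+1}=\bar\lambda^k+\rho_k h(x^k)$ and $\mu^{k+1}=(\bar\mu^k+\rho_k g(x^k))_+$; choose any $\bar\lambda^{k+1}\in[\lambda_{\min},\lambda_{\max}]^m$ and $\bar\mu^{k+1}\in[0,\mu_{\max}]^p$. The algorithm has no stopping criterion and generates infinite sequences. Inner iterations are the iterations of the (iterative) method used at Step 1; the total cost is the sum of the Step 1 costs over the iterations performed. $c_{\mathrm{big}}>0$ denotes a constant such that $\max\{\|h(x^k)\|_\infty,\|V^k\|_\infty\}\le c_{\mathrm{big}}$ for all $k\ge1$ (such a constant exists).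
   Formalization: c_big is required to bound the Euclidean norms max{‖h(x^k)‖,‖V^k‖} tested at Step 2, since with max-norms the claim fails; the bracket [a] is read as the least natural number exceeding a. *)

theory Defs
  imports "HOL-Analysis.Analysis"
begin

definition continuously_differentiable :: "('a::euclidean_space \<Rightarrow> 'b::euclidean_space) \<Rightarrow> bool" where
  "continuously_differentiable F \<longleftrightarrow>
     (\<exists>F' :: 'a \<Rightarrow> 'a \<Rightarrow>\<^sub>L 'b.
        (\<forall>x. (F has_derivative blinfun_apply (F' x)) (at x)) \<and> continuous_on UNIV F')"

definition gradient :: "('a::real_inner \<Rightarrow> real) \<Rightarrow> 'a \<Rightarrow> 'a" where
  "gradient F x = (THE D. GDERIV F x :> D)"

(* Column j is the gradient of the j-th component, i.e. the transpose of the Jacobian. *)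
definition gradient_matrix :: "(real^'n \<Rightarrow> real^'m) \<Rightarrow> real^'n \<Rightarrow> real^'m^'n" where
  "gradient_matrix F x = (\<chi> i j. gradient (\<lambda>y. F y $ j) x $ i)"

definition pos_part :: "real^'p \<Rightarrow> real^'p" where
  "pos_part v = (\<chi> i. max 0 (v $ i))"

definition aug_lagrangian ::
  "(real^'n \<Rightarrow> real) \<Rightarrow> (real^'n \<Rightarrow> real^'m) \<Rightarrow> (real^'n \<Rightarrow> real^'p) \<Rightarrow>
   real \<Rightarrow> real^'m \<Rightarrow> real^'p \<Rightarrow> real^'n \<Rightarrow> real" where
  "aug_lagrangian f h g \<rho> lam \<mu> x =
     f x + \<rho> / 2 * ((\<Sum>i\<in>UNIV. (h x $ i + lam $ i / \<rho>)\<^sup>2) +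
                    (\<Sum>i\<in>UNIV. (max 0 (g x $ i + \<mu> $ i / \<rho>))\<^sup>2))"

(* closest_point is the Euclidean projection, cbox l u the box of all x with l \<le> x \<le> u. *)
definition projected_step :: "real^'n \<Rightarrow> real^'n \<Rightarrow> real^'n \<Rightarrow> real^'n \<Rightarrow> real^'n" where
  "projected_step l u x d = closest_point (cbox l u) (x - d) - x"

definition V_vec :: "(real^'n \<Rightarrow> real^'p) \<Rightarrow> real \<Rightarrow> real^'p \<Rightarrow> real^'n \<Rightarrow> real^'p" where
  "V_vec g \<rho> \<mu> x = (\<chi> i. min (- (g x $ i)) (\<mu> $ i / \<rho>))"

(* The quantity monitored by the penalty update, in the Euclidean norm. A constant c_big that enters
   the iteration bound has to dominate this quantity: a run of t iterations with unchanged penalty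
   yields max-norm values \<le> \<tau>^t * c_big only if the Euclidean values start below c_big, and
   bounding the max-norms alone leaves a factor up to sqrt (max m p). *)
definition infeas_compl ::
  "(real^'n \<Rightarrow> real^'m) \<Rightarrow> (real^'n \<Rightarrow> real^'p) \<Rightarrow> real \<Rightarrow> real^'p \<Rightarrow> real^'n \<Rightarrow> real" where
  "infeas_compl h g \<rho> \<mu> x = max (norm (h x)) (norm (V_vec g \<rho> \<mu> x))"

(* An infinite run of the Augmented Lagrangian method. Iterations are numbered from 1; x 0 is the
   arbitrary initial point. lbar, mubar are the safeguarded multipliers; lam (k+1), mu (k+1) are the
   multiplier estimates produced by iteration k. The values of the sequences at other indices are
   irrelevant. *)
locale aug_lagrangian_run =
  fixes f :: "real^'n \<Rightarrow> real"
    and h :: "real^'n \<Rightarrow> real^'m"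
    and g :: "real^'n \<Rightarrow> real^'p"
    and l u :: "real^'n"
    and lam_min lam_max mu_max :: real
    and rho1 gamma tau :: real
    and eps :: "nat \<Rightarrow> real"
    and x :: "nat \<Rightarrow> real^'n"
    and rho :: "nat \<Rightarrow> real"
    and lbar lam :: "nat \<Rightarrow> real^'m"
    and mubar mu :: "nat \<Rightarrow> real^'p"
  assumes f_C1: "continuously_differentiable f"
    and h_C1: "continuously_differentiable h"
    and g_C1: "continuously_differentiable g"
    and lam_bounds: "lam_min < lam_max"
    and mu_max_pos: "0 < mu_max"
    and rho1_pos: "0 < rho1"
    and gamma_gt_1: "1 < gamma"
    and tau_bounds: "0 < tau" "tau < 1"
    and eps_pos: "\<And>k. 1 \<le> k \<Longrightarrow> 0 < eps k"
    and lbar_range: "\<And>k i. 1 \<le> k \<Longrightarrow> lbar k $ i \<in> {lam_min..lam_max}"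
    and mubar_range: "\<And>k i. 1 \<le> k \<Longrightarrow> mubar k $ i \<in> {0..mu_max}"
    and rho_first: "rho 1 = rho1"
    and step1_box: "\<And>k. 1 \<le> k \<Longrightarrow> x k \<in> cbox l u"
    and step1_tol: "\<And>k. 1 \<le> k \<Longrightarrow>
          norm (projected_step l u (x k)
                  (gradient (aug_lagrangian f h g (rho k) (lbar k) (mubar k)) (x k))) \<le> eps k"
    and step2: "\<And>k. 1 \<le> k \<Longrightarrow>
          rho (k + 1) =
            (if k = 1 \<or>
                infeas_compl h g (rho k) (mubar k) (x k)
                  \<le> tau * infeas_compl h g (rho (k - 1)) (mubar (k - 1)) (x (k - 1))
             then rho k else gamma * rho k)"
    and step3_lam: "\<And>k. 1 \<le> k \<Longrightarrow> lam (k + 1) = lbar k + rho k *\<^sub>R h (x k)"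
    and step3_mu: "\<And>k. 1 \<le> k \<Longrightarrow> mu (k + 1) = pos_part (mubar k + rho k *\<^sub>R g (x k))"

(* Stopping test at a point x with multipliers lam, \<mu>; infnorm is the maximum norm. *)
definition approx_KKT ::
  "(real^'n \<Rightarrow> real) \<Rightarrow> (real^'n \<Rightarrow> real^'m) \<Rightarrow> (real^'n \<Rightarrow> real^'p) \<Rightarrow> real^'n \<Rightarrow> real^'n \<Rightarrow>
   real \<Rightarrow> real \<Rightarrow> real^'n \<Rightarrow> real^'m \<Rightarrow> real^'p \<Rightarrow> bool" where
  "approx_KKT f h g l u \<epsilon> \<delta> x lam \<mu> \<longleftrightarrow>
     norm (projected_step l u x
             (gradient f x + gradient_matrix h x *v lam + gradient_matrix g x *v \<mu>)) \<le> \<epsilon> \<and>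
     infnorm (h x) \<le> \<delta> \<and>
     infnorm (pos_part (g x)) \<le> \<delta> \<and>
     (\<forall>j. g x $ j < - \<delta> \<longrightarrow> \<mu> $ j = 0)"

(* Reading of the bracket [a] that turns a ratio of logarithms into a number of iterations: the
   number of naturals \<le> a, i.e. the least natural number exceeding a. For
   a = log (\<rho>_big / \<rho>_1) / log \<gamma> it is the least t with \<rho>_1 * \<gamma>^t > \<rho>_big; for
   a = log (\<delta> / c_big) / log \<tau> it is the least t with c_big * \<tau>^t < \<delta>. The ceiling is
   one too small for the first ratio when it is an integer; for a negative ratio (c_big < \<delta>)
   the value is 0. *)
definition bracket :: "real \<Rightarrow> nat" where
  "bracket a = nat (\<lfloor>a\<rfloor> + 1)"

definition iteration_bound :: "nat \<Rightarrow> real \<Rightarrow> real \<Rightarrow> real \<Rightarrow> real \<Rightarrow> real \<Rightarrow> real \<Rightarrow> nat" where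
  "iteration_bound N rho_big rho1 gamma \<delta> c_big tau =
     N + bracket (ln (rho_big / rho1) / ln gamma) * bracket (ln (\<delta> / c_big) / ln tau)"

end

theory Submission
  imports Defs
begin

text \<open>The gradient of the augmented Lagrangian is that of the Lagrangian at the updated multipliers,
  so the Step 1 test at an iteration \<open>k\<close> with \<open>\<epsilon>\<^sub>k \<le> \<epsilon>\<close> is the stationarity part of the stopping test;
  the other parts follow from \<open>max (\<parallel>h(x\<^sub>k)\<parallel>) (\<parallel>V\<^sub>k\<parallel>) \<le> \<delta>\<close>. Let \<open>a\<close> and \<open>b\<close> be the two brackets and
  split the iterations \<open>N + 1, \<dots>, N + a b\<close> into \<open>a\<close> blocks of length \<open>b\<close>. Either every block contains a
  penalty increase, and then the penalty is at least \<open>\<rho>\<^sub>1 \<gamma>\<^sup>a > \<rho>\<^sub>b\<^sub>i\<^sub>g\<close>, or some block contains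
  none, and then the monitored quantity is at most \<open>\<tau>\<^sup>b c\<^sub>b\<^sub>i\<^sub>g < \<delta>\<close> at its end.\<close>

section \<open>Gradients, and the gradient of the augmented Lagrangian\<close>

lemma gradient_eqI:
  assumes "GDERIV F x :> D"
  shows "gradient F x = D"
  unfolding gradient_def
proof (rule the_equality)
  fix D' assume "GDERIV F x :> D'"
  then have "(\<lambda>v. v \<bullet> D') = (\<lambda>v. v \<bullet> D)"
    using assms unfolding gderiv_def by (rule has_derivative_unique)
  then show "D' = D"
    by (metis vector_eq_ldot)
qed (fact assms)

lemma GDERIV_gradient:
  fixes F :: "'a::euclidean_space \<Rightarrow> real"
  assumes "F differentiable at x"
  shows "GDERIV F x :> gradient F x"
proof -
  obtain F' where F': "(F has_derivative F') (at x)"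
    using assms unfolding differentiable_def by blast
  interpret F': bounded_linear F'
    using F' by (rule has_derivative_bounded_linear)
  \<comment> \<open>The Riesz representative of \<open>F'\<close>: its coordinates in the
    orthonormal \<open>Basis\<close> are the values of \<open>F'\<close> there.\<close>
  define D where "D = (\<Sum>b\<in>Basis. F' b *\<^sub>R b)"
  have "F' v = v \<bullet> D" for v
  proof -
    have "F' v = F' (\<Sum>b\<in>Basis. (v \<bullet> b) *\<^sub>R b)"
      by (simp add: euclidean_representation)
    also have "\<dots> = v \<bullet> D"
      by (simp add: D_def F'.sum F'.scaleR inner_sum_right mult.commute)
    finally show ?thesis .
  qed
  then have "GDERIV F x :> D"
    using F' unfolding gderiv_def by presburger
  then show ?thesis
    using gradient_eqI by metis
qed

lemma continuously_differentiable_imp_differentiable: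
  "continuously_differentiable F \<Longrightarrow> F differentiable at x"
  unfolding continuously_differentiable_def differentiable_def by blast

lemma differentiable_vec_nth:
  fixes F :: "'a::euclidean_space \<Rightarrow> real^'m"
  assumes "F differentiable at x"
  shows "(\<lambda>y. F y $ i) differentiable at x"
  using assms bounded_linear.has_derivative[OF bounded_linear_vec_nth]
  unfolding differentiable_def by fast

lemma gradient_matrix_mult_vec:
  "gradient_matrix F x *v v = (\<Sum>i\<in>UNIV. v $ i *\<^sub>R gradient (\<lambda>y. F y $ i) x)"
  by (simp add: vec_eq_iff gradient_matrix_def matrix_vector_mult_def mult.commute)

text \<open>Squaring removes the kink of \<open>max 0 t\<close>: away from 0 the function agrees
  locally with 0 or with the square, and at 0 the difference quotient is at most
  \<open>\<bar>s\<bar>\<close> in absolute value.\<close>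

lemma DERIV_max_0_square:
  "DERIV (\<lambda>t::real. (max 0 t)\<^sup>2) t :> 2 * max 0 t"
proof (cases t "0::real" rule: linorder_cases)
  case less
  have "DERIV (\<lambda>t::real. 0) t :> 2 * max 0 t"
    using less by simp
  then show ?thesis
    by (rule has_field_derivative_transform_within_open[where S = "{..<0}"])
      (use less in auto)
next
  case greater
  have "DERIV (\<lambda>t::real. t\<^sup>2) t :> 2 * max 0 t"
    using greater by (auto intro!: derivative_eq_intros)
  then show ?thesis
    by (rule has_field_derivative_transform_within_open[where S = "{0<..}"])
      (use greater in auto)
next
  case equal
  have "((\<lambda>s::real. (max 0 s)\<^sup>2 / s) \<longlongrightarrow> 0) (at 0)"
  proof (rule Lim_null_comparison)
    show "\<forall>\<^sub>F s::real in at 0. norm ((max 0 s)\<^sup>2 / s) \<le> \<bar>s\<bar>"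
      by (rule always_eventually) (auto simp: max_def power2_eq_square)
    show "((\<lambda>s::real. \<bar>s\<bar>) \<longlongrightarrow> 0) (at 0)"
      by (intro tendsto_rabs_zero tendsto_ident_at)
  qed
  then show ?thesis
    using equal by (simp add: DERIV_def)
qed

lemma GDERIV_sum:
  assumes "\<And>i. i \<in> I \<Longrightarrow> GDERIV (F i) x :> D i"
  shows "GDERIV (\<lambda>y. \<Sum>i\<in>I. F i y) x :> (\<Sum>i\<in>I. D i)"
  using assms unfolding gderiv_def inner_sum_right by (rule has_derivative_sum)

lemma gradient_aug_lagrangian:
  fixes f :: "real^'n \<Rightarrow> real" and h :: "real^'n \<Rightarrow> real^'m" and g :: "real^'n \<Rightarrow> real^'p"
  assumes "f differentiable at x" "h differentiable at x" "g differentiable at x" "0 < \<rho>"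
  shows "gradient (aug_lagrangian f h g \<rho> lam \<mu>) x =
    gradient f x + gradient_matrix h x *v (lam + \<rho> *\<^sub>R h x) +
    gradient_matrix g x *v pos_part (\<mu> + \<rho> *\<^sub>R g x)"
proof (rule gradient_eqI)
  let ?dh = "\<lambda>i. gradient (\<lambda>y. h y $ i) x" and ?dg = "\<lambda>i. gradient (\<lambda>y. g y $ i) x"
  have dh: "GDERIV (\<lambda>y. (h y $ i + lam $ i / \<rho>)\<^sup>2) x :>
      (2 * (h x $ i + lam $ i / \<rho>)) *\<^sub>R ?dh i" for i
  proof (rule GDERIV_DERIV_compose[where f = "\<lambda>y. h y $ i" and g = "\<lambda>t. (t + lam $ i / \<rho>)\<^sup>2"])
    show "GDERIV (\<lambda>y. h y $ i) x :> ?dh i"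
      by (intro GDERIV_gradient differentiable_vec_nth assms)
  qed (auto intro!: derivative_eq_intros)
  have dg: "GDERIV (\<lambda>y. (max 0 (g y $ i + \<mu> $ i / \<rho>))\<^sup>2) x :>
      (2 * max 0 (g x $ i + \<mu> $ i / \<rho>)) *\<^sub>R ?dg i" for i
  proof (rule GDERIV_DERIV_compose[where f = "\<lambda>y. g y $ i" and
        g = "\<lambda>t. (max 0 (t + \<mu> $ i / \<rho>))\<^sup>2"])
    show "GDERIV (\<lambda>y. g y $ i) x :> ?dg i"
      by (intro GDERIV_gradient differentiable_vec_nth assms)
    show "DERIV (\<lambda>t. (max 0 (t + \<mu> $ i / \<rho>))\<^sup>2) (g x $ i) :>
        2 * max 0 (g x $ i + \<mu> $ i / \<rho>)"
      by (rule iffD1[OF DERIV_shift[where f = "\<lambda>t. (max 0 t)\<^sup>2"] DERIV_max_0_square])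
  qed
  have "GDERIV (aug_lagrangian f h g \<rho> lam \<mu>) x :> gradient f x + (\<rho> / 2) *\<^sub>R
      ((\<Sum>i\<in>UNIV. (2 * (h x $ i + lam $ i / \<rho>)) *\<^sub>R ?dh i) +
       (\<Sum>i\<in>UNIV. (2 * max 0 (g x $ i + \<mu> $ i / \<rho>)) *\<^sub>R ?dg i))"
    unfolding aug_lagrangian_def[abs_def]
    using GDERIV_add[OF GDERIV_gradient[OF assms(1)]
        GDERIV_mult[OF GDERIV_const[of "\<rho> / 2"] GDERIV_add[OF GDERIV_sum[OF dh] GDERIV_sum[OF dg]]]]
    by simp
  \<comment> \<open>The factor \<rho>, left after \<open>\<rho> / 2\<close> meets the 2 from the
    square, turns the shifted constraint values into the multipliers of Step 3; being positive, it
    passes inside the \<open>max\<close>.\<close>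
  moreover have "\<rho> * max 0 (g x $ i + \<mu> $ i / \<rho>) = max 0 (\<mu> $ i + \<rho> * g x $ i)" for i
    using \<open>0 < \<rho>\<close> max_mult_distrib_left[of \<rho> 0 "g x $ i + \<mu> $ i / \<rho>"]
    by (simp add: distrib_left add.commute)
  moreover have "\<rho> * (h x $ i + lam $ i / \<rho>) = lam $ i + \<rho> * h x $ i" for i
    using \<open>0 < \<rho>\<close> by (simp add: distrib_left)
  ultimately show "GDERIV (aug_lagrangian f h g \<rho> lam \<mu>) x :>
      gradient f x + gradient_matrix h x *v (lam + \<rho> *\<^sub>R h x) +
      gradient_matrix g x *v pos_part (\<mu> + \<rho> *\<^sub>R g x)"
    by (simp add: gradient_matrix_mult_vec pos_part_def scaleR_add_right scaleR_sum_right add.assoc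
        del: distrib_left_numeral)
qed

section \<open>From small infeasibility to the stopping test\<close>

lemma infnorm_vec_le:
  fixes v :: "real^'n"
  assumes "\<And>i. \<bar>v $ i\<bar> \<le> c"
  shows "infnorm v \<le> c"
  unfolding infnorm_cart using assms by (intro cSup_least) auto

text \<open>All claims about \<open>g\<close> come from the size of one minimum per component. If it
  equals \<open>- (g x $ j)\<close>, then \<open>g x $ j\<close> lies within \<delta> of 0; if it
  equals the nonnegative \<open>\<mu> $ j / \<rho>\<close>, then \<open>g x $ j\<close> is at most
  0.\<close>

lemma approx_KKT_of_infeas_compl_le:
  fixes f :: "real^'n \<Rightarrow> real" and h :: "real^'n \<Rightarrow> real^'m" and g :: "real^'n \<Rightarrow> real^'p"
  assumes diff: "f differentiable at x" "h differentiable at x" "g differentiable at x"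
    and \<rho>: "0 < \<rho>" and \<mu>: "\<And>i. 0 \<le> \<mu> $ i"
    and tol: "norm (projected_step l u x (gradient (aug_lagrangian f h g \<rho> lam \<mu>) x)) \<le> \<epsilon>"
    and infeas: "infeas_compl h g \<rho> \<mu> x \<le> \<delta>"
  shows "approx_KKT f h g l u \<epsilon> \<delta> x (lam + \<rho> *\<^sub>R h x) (pos_part (\<mu> + \<rho> *\<^sub>R g x))"
proof -
  have V: "\<bar>min (- (g x $ j)) (\<mu> $ j / \<rho>)\<bar> \<le> \<delta>" for j
    using infeas component_le_norm_cart[of "V_vec g \<rho> \<mu> x" j]
    by (simp add: infeas_compl_def V_vec_def)
  have \<mu>': "0 \<le> \<mu> $ j / \<rho>" for j
    using \<rho> \<mu> by simp
  have "infnorm (h x) \<le> \<delta>"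
    using infeas infnorm_le_norm[of "h x"] by (simp add: infeas_compl_def)
  moreover have "infnorm (pos_part (g x)) \<le> \<delta>"
  proof (rule infnorm_vec_le)
    show "\<bar>pos_part (g x) $ j\<bar> \<le> \<delta>" for j
      using V[of j] \<mu>'[of j] by (auto simp: pos_part_def)
  qed
  moreover have "pos_part (\<mu> + \<rho> *\<^sub>R g x) $ j = 0" if "g x $ j < - \<delta>" for j
  proof -
    \<comment> \<open>Here \<open>- (g x $ j)\<close> exceeds \<delta>, so the minimum must be the
      other entry, which is therefore at most \<open>- (g x $ j)\<close>.\<close>
    have "\<mu> $ j / \<rho> + g x $ j \<le> 0"
      using V[of j] \<mu>'[of j] that by (simp add: min_def split: if_splits)
    then have "\<mu> $ j + \<rho> * g x $ j \<le> 0"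
      using \<rho> by (simp add: field_simps)
    then show ?thesis
      by (simp add: pos_part_def)
  qed
  ultimately show ?thesis
    using tol gradient_aug_lagrangian[OF diff \<rho>, of lam \<mu>] by (simp add: approx_KKT_def)
qed

section \<open>Iteration counts from ratios of logarithms\<close>

lemma less_bracket: "a < real (bracket a)"
  unfolding bracket_def by linarith

text \<open>Multiply \<open>less_bracket\<close> by the positive \<open>ln b\<close> and
  exponentiate. Its strictness gives a strict excess even for an integer ratio; a negative ratio
  means \<open>d < c\<close>, where the exponent 0 suffices.\<close>

lemma power_bracket_gt:
  fixes b c d :: real
  assumes "1 < b" "0 < c" "0 < d"
  shows "d < c * b ^ bracket (ln (d / c) / ln b)"
proof -
  let ?n = "bracket (ln (d / c) / ln b)"
  have "ln (d / c) < real ?n * ln b"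
    using less_bracket[of "ln (d / c) / ln b"] assms by (simp add: divide_less_eq)
  then have "ln (d / c) < ln (b ^ ?n)"
    using assms by (simp add: ln_realpow)
  then have "d / c < b ^ ?n"
    using assms by (subst (asm) ln_less_cancel_iff) auto
  then show ?thesis
    using assms by (simp add: divide_less_eq mult.commute)
qed

text \<open>Passing to reciprocals flips the signs of both logarithms, so their ratio, and with it
  the exponent, is the one in \<open>power_bracket_gt\<close>.\<close>

lemma power_bracket_less:
  fixes b c d :: real
  assumes "0 < b" "b < 1" "0 < c" "0 < d"
  shows "c * b ^ bracket (ln (d / c) / ln b) < d"
proof -
  have "ln (inverse d / inverse c) / ln (inverse b) = ln (d / c) / ln b"
    using assms by (simp add: ln_div ln_inverse minus_divide_left)
  then have "inverse d < inverse c * inverse b ^ bracket (ln (d / c) / ln b)"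
    using power_bracket_gt[of "inverse b" "inverse c" "inverse d"] assms
    by (simp add: one_less_inverse)
  then show ?thesis
    using assms by (simp add: field_simps)
qed

lemma geometric_decrease:
  fixes E :: "nat \<Rightarrow> real"
  assumes "0 \<le> \<tau>" and "\<And>k. m < k \<Longrightarrow> k \<le> m + n \<Longrightarrow> E k \<le> \<tau> * E (k - 1)"
  shows "E (m + n) \<le> \<tau> ^ n * E m"
  using assms(2)
proof (induction n)
  case (Suc n)
  have "E (m + Suc n) \<le> \<tau> * E (m + n)"
    using Suc.prems[of "m + Suc n"] by simp
  also have "\<dots> \<le> \<tau> * (\<tau> ^ n * E m)"
    using Suc.IH Suc.prems \<open>0 \<le> \<tau>\<close> by (intro mult_left_mono) auto
  finally show ?case
    by (simp add: mult.assoc)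
qed simp

section \<open>Penalty growth against decrease of the infeasibility along a run\<close>

context aug_lagrangian_run
begin

lemma rho_step:
  assumes "1 \<le> k"
  shows "rho (k + 1) = rho k \<or> rho (k + 1) = gamma * rho k"
  using step2[OF assms] by presburger

lemma rho_pos:
  assumes "1 \<le> k"
  shows "0 < rho k"
  using assms
proof (induction k rule: dec_induct)
  case base
  then show ?case
    using rho_first rho1_pos by simp
next
  case (step k)
  then show ?case
    using rho_step[of k] gamma_gt_1 by auto
qed

lemma rho_Suc_ge:
  assumes "1 \<le> k"
  shows "rho k \<le> rho (k + 1)"
  using rho_step[OF assms] rho_pos[OF assms] gamma_gt_1 by auto

lemma rho_mono:
  assumes "1 \<le> j" "j \<le> k"
  shows "rho j \<le> rho k"
  using assms(2)
proof (induction k rule: dec_induct)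
  case (step k)
  then show ?case
    using rho_Suc_ge[of k] assms(1) by simp
qed simp

definition infeas :: "nat \<Rightarrow> real" where
  "infeas k = infeas_compl h g (rho k) (mubar k) (x k)"

text \<open>Iteration 1 is excluded because Step 2 always keeps the penalty there.\<close>

lemma rho_increase:
  assumes "2 \<le> k" "\<not> infeas k \<le> tau * infeas (k - 1)"
  shows "rho (k + 1) = gamma * rho k"
  using step2[of k] assms by (simp add: infeas_def)

text \<open>Induction on the number of blocks: a new block either passes the test of Step 2
  throughout, which shrinks the infeasibility geometrically, or fails it once, which gains a factor
  \<open>gamma\<close>. A failure at iteration \<open>k\<close> shows only in
  \<open>rho (k + 1)\<close>, hence the index \<open>n + a * b + 1\<close>.\<close>

lemma rho_growth_or_infeas_decrease:
  assumes "1 \<le> n"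
  shows "rho1 * gamma ^ a \<le> rho (n + a * b + 1) \<or>
    (\<exists>i<a. infeas (n + i * b + b) \<le> tau ^ b * infeas (n + i * b))"
proof (induction a)
  case 0
  then show ?case
    using rho_mono[of 1 "n + 1"] rho_first by simp
next
  case (Suc a)
  let ?m = "n + a * b"
  consider (grow) "rho1 * gamma ^ a \<le> rho (?m + 1)"
    | (dec) "\<exists>i<a. infeas (n + i * b + b) \<le> tau ^ b * infeas (n + i * b)"
    using Suc.IH by blast
  then show ?case
  proof cases
    case grow
    show ?thesis
    proof (cases "\<forall>k. ?m < k \<and> k \<le> ?m + b \<longrightarrow> infeas k \<le> tau * infeas (k - 1)")
      case True
      then have "infeas (?m + b) \<le> tau ^ b * infeas ?m"
        using tau_bounds by (intro geometric_decrease) auto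
      then show ?thesis
        by blast
    next
      case False
      then obtain k where k: "?m < k" "k \<le> ?m + b" "\<not> infeas k \<le> tau * infeas (k - 1)"
        by blast
      have "rho1 * gamma ^ Suc a = gamma * (rho1 * gamma ^ a)"
        by simp
      also have "\<dots> \<le> gamma * rho (?m + 1)"
        using grow gamma_gt_1 by (intro mult_left_mono) auto
      also have "\<dots> \<le> gamma * rho k"
        using rho_mono[of "?m + 1" k] k gamma_gt_1 by (intro mult_left_mono) auto
      \<comment> \<open>From \<open>1 \<le> n\<close> and \<open>n + a * b < k\<close> follows
        \<open>2 \<le> k\<close>, so the exemption of iteration 1 cannot apply.\<close>
      also have "\<dots> = rho (k + 1)"
        using rho_increase[of k] k assms by simp
      also have "\<dots> \<le> rho (n + Suc a * b + 1)"
        using k by (intro rho_mono) auto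
      finally show ?thesis
        by blast
    qed
  next
    case dec
    then show ?thesis
      using less_SucI by blast
  qed
qed

lemma approx_KKT_iterate:
  assumes "1 \<le> k" "eps k \<le> \<epsilon>" "infeas k \<le> \<delta>"
  shows "approx_KKT f h g l u \<epsilon> \<delta> (x k) (lam (k + 1)) (mu (k + 1))"
  unfolding step3_lam[OF assms(1)] step3_mu[OF assms(1)]
proof (rule approx_KKT_of_infeas_compl_le)
  show "0 \<le> mubar k $ i" for i
    using mubar_range[OF assms(1), of i] by simp
qed (use assms step1_tol[OF assms(1)] rho_pos f_C1 h_C1 g_C1 in
    \<open>auto simp: infeas_def intro: continuously_differentiable_imp_differentiable\<close>)

text \<open>The blocks start at \<open>N\<close> rather than at 1, so that the iteration found also
  meets the tolerance \<epsilon> in the final theorem.\<close>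

lemma infeas_le_delta_or_rho_large:
  assumes "\<And>k. 1 \<le> k \<Longrightarrow> infeas k \<le> c_big" "0 < c_big" "0 < \<delta>" "rho1 < rho_big" "1 \<le> N"
  defines "K \<equiv> iteration_bound N rho_big rho1 gamma \<delta> c_big tau"
  shows "rho_big < rho (K + 1) \<or> (\<exists>k. N \<le> k \<and> k \<le> K \<and> infeas k \<le> \<delta>)"
proof -
  define a where "a = bracket (ln (rho_big / rho1) / ln gamma)"
  define b where "b = bracket (ln (\<delta> / c_big) / ln tau)"
  have K: "K = N + a * b"
    by (simp add: K_def a_def b_def iteration_bound_def)
  show ?thesis
    using rho_growth_or_infeas_decrease[OF \<open>1 \<le> N\<close>, of a b]
  proof (elim disjE exE conjE)
    assume "rho1 * gamma ^ a \<le> rho (N + a * b + 1)"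
    moreover have "rho_big < rho1 * gamma ^ a"
      unfolding a_def using assms gamma_gt_1 rho1_pos by (intro power_bracket_gt) auto
    ultimately show ?thesis
      by (simp add: K)
  next
    fix i assume i: "i < a" "infeas (N + i * b + b) \<le> tau ^ b * infeas (N + i * b)"
    \<comment> \<open>\<open>c_big\<close> bounds the infeasibility at the start of the block. An
      empty block, \<open>b = 0\<close>, arises only if \<open>c_big < \<delta>\<close>, and then
      this start already qualifies.\<close>
    have "tau ^ b * infeas (N + i * b) \<le> tau ^ b * c_big"
      using assms(1)[of "N + i * b"] assms(5) tau_bounds by (intro mult_left_mono) auto
    moreover have "c_big * tau ^ b < \<delta>"
      unfolding b_def using assms tau_bounds by (intro power_bracket_less) auto
    ultimately have "infeas (N + i * b + b) \<le> \<delta>"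
      using i by (simp add: mult.commute)
    \<comment> \<open>The block ends at \<open>N + Suc i * b\<close>, so this keeps its end within
      the budget \<open>K\<close>.\<close>
    moreover have "Suc i * b \<le> a * b"
      using i by (intro mult_right_mono) auto
    ultimately show ?thesis
      by (intro disjI2 exI[of _ "N + i * b + b"]) (simp add: K)
  qed
qed

end

section \<open>Summing the costs of Step 1\<close>

text \<open>A negative power decreases, so the smallest tolerance gives a common bound for at most
  \<open>K\<close> terms. For \<open>K = 0\<close> the minimum is over the empty set, but the factor
  \<open>K\<close> makes the bound 0.\<close>

lemma sum_cost_le:
  fixes cost :: "nat \<Rightarrow> nat" and eps :: "nat \<Rightarrow> real"
  assumes "0 \<le> C" "0 \<le> q" and "J \<subseteq> {1..K}"
    and "\<And>k. k \<in> {1..K} \<Longrightarrow> 0 < eps k"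
    and "\<And>k. k \<in> J \<Longrightarrow> real (cost k) \<le> C * eps k powr (- q)"
  shows "real (\<Sum>k\<in>J. cost k) \<le> C * Min {eps k | k. 1 \<le> k \<and> k \<le> K} powr (- q) * real K"
proof -
  let ?S = "{eps k | k. 1 \<le> k \<and> k \<le> K}"
  have S: "?S = eps ` {1..K}"
    by auto
  have "real (cost k) \<le> C * Min ?S powr (- q)" if "k \<in> J" for k
  proof -
    have k: "k \<in> {1..K}"
      using that assms(3) by blast
    then have "Min ?S \<in> ?S"
      unfolding S by (intro Min_in) auto
    then have "0 < Min ?S"
      using assms(4) unfolding S by auto
    moreover have "Min ?S \<le> eps k"
      using k unfolding S by (intro Min_le) auto
    ultimately have "eps k powr (- q) \<le> Min ?S powr (- q)"
      using \<open>0 \<le> q\<close> by (intro powr_mono2') auto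
    then show ?thesis
      using assms(5)[OF that] mult_left_mono[OF _ \<open>0 \<le> C\<close>] by (meson order_trans)
  qed
  then have "real (\<Sum>k\<in>J. cost k) \<le> real (card J) * (C * Min ?S powr (- q))"
    unfolding of_nat_sum by (rule sum_bounded_above)
  also have "\<dots> \<le> real K * (C * Min ?S powr (- q))"
    using card_mono[OF _ assms(3)] \<open>0 \<le> C\<close> by (intro mult_right_mono) auto
  finally show ?thesis
    by (simp add: mult.commute)
qed

theorem theorem3p4:
  fixes f :: "real^'n \<Rightarrow> real"
    and h :: "real^'n \<Rightarrow> real^'m"
    and g :: "real^'n \<Rightarrow> real^'p"
    and l u :: "real^'n"
    and lam_min lam_max mu_max rho1 gamma tau :: real
    and eps :: "nat \<Rightarrow> real"
    and x :: "nat \<Rightarrow> real^'n"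
    and rho :: "nat \<Rightarrow> real"
    and lbar lam :: "nat \<Rightarrow> real^'m"
    and mubar mu :: "nat \<Rightarrow> real^'p"
    and \<delta> \<epsilon> rho_big c_big q :: real
    and N :: nat
    and c_inner :: "real \<Rightarrow> real \<Rightarrow> real \<Rightarrow> real \<Rightarrow> real^'n \<Rightarrow> real^'n \<Rightarrow>
          (real^'n \<Rightarrow> real) \<Rightarrow> (real^'n \<Rightarrow> real^'m) \<Rightarrow> (real^'n \<Rightarrow> real^'p) \<Rightarrow> real"
    and inner_its f_evals d_evals :: "nat \<Rightarrow> nat"
  defines "C \<equiv> c_inner rho_big lam_min lam_max mu_max l u f h g"
    and "K_max \<equiv> iteration_bound N rho_big rho1 gamma \<delta> c_big tau"
  defines "eps_min2 \<equiv> Min {eps k | k. 1 \<le> k \<and> k \<le> K_max}"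
  assumes run: "aug_lagrangian_run f h g l u lam_min lam_max mu_max rho1 gamma tau eps
                  x rho lbar lam mubar mu"
    and c_big_pos: "0 < c_big"
    and c_big: "\<And>k. 1 \<le> k \<Longrightarrow> infeas_compl h g (rho k) (mubar k) (x k) \<le> c_big"
    and \<delta>_pos: "0 < \<delta>"
    and \<epsilon>_pos: "0 < \<epsilon>"
    and rho_big: "rho1 < rho_big"
    and N_pos: "1 \<le> N"
    and N: "\<And>k. N \<le> k \<Longrightarrow> eps k \<le> \<epsilon>"
    and c_inner_pos: "0 < C"
    and q_pos: "0 < q"
    and step1_cost: "\<And>k cost. 1 \<le> k \<Longrightarrow> rho k \<le> rho_big \<Longrightarrow>
          cost \<in> {inner_its, f_evals, d_evals} \<Longrightarrow> real (cost k) \<le> C * eps k powr (- q)"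
  shows "\<exists>k\<ge>1.
      (approx_KKT f h g l u \<epsilon> \<delta> (x k) (lam (k + 1)) (mu (k + 1)) \<and>
       (\<forall>cost \<in> {inner_its, f_evals, d_evals}.
          real (\<Sum>j=1..k. cost j) \<le> C * eps_min2 powr (- q) * real K_max)) \<or>
      (rho k > rho_big \<and>
       (\<forall>cost \<in> {inner_its, f_evals, d_evals}.
          real (\<Sum>j=1..<k. cost j) \<le> C * eps_min2 powr (- q) * real K_max))"
proof -
  interpret run: aug_lagrangian_run f h g l u lam_min lam_max mu_max rho1 gamma tau eps
      x rho lbar lam mubar mu
    by (fact run)
  \<comment> \<open>Step 1 costs are bounded only while the penalty is at most
    \<open>rho_big\<close>, so \<open>J\<close> is restricted to such iterations.\<close>
  have cost: "\<forall>cost \<in> {inner_its, f_evals, d_evals}.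
      real (\<Sum>j\<in>J. cost j) \<le> C * eps_min2 powr (- q) * real K_max"
    if J: "J \<subseteq> {1..K_max}" and small: "\<And>j. j \<in> J \<Longrightarrow> rho j \<le> rho_big" for J
  proof
    fix cost assume "cost \<in> {inner_its, f_evals, d_evals}"
    with J small show "real (\<Sum>j\<in>J. cost j) \<le> C * eps_min2 powr (- q) * real K_max"
      unfolding eps_min2_def using c_inner_pos q_pos run.eps_pos
      by (intro sum_cost_le step1_cost) auto
  qed
  show ?thesis
  proof (cases "\<exists>k. 1 \<le> k \<and> k \<le> K_max + 1 \<and> rho_big < rho k")
    case True
    \<comment> \<open>Minimality of \<open>k\<close> makes the cost bound available at all earlier
      iterations. The value \<open>rho k\<close> is known before Step 1 of iteration
      \<open>k\<close>, so only \<open>{1..<k}\<close> is charged.\<close>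
    then obtain k where k: "1 \<le> k" "k \<le> K_max + 1" "rho_big < rho k"
      and least: "\<And>j. j < k \<Longrightarrow> \<not> (1 \<le> j \<and> j \<le> K_max + 1 \<and> rho_big < rho j)"
      using exists_least_iff[of "\<lambda>k. 1 \<le> k \<and> k \<le> K_max + 1 \<and> rho_big < rho k"] by blast
    have "rho j \<le> rho_big" if "j \<in> {1..<k}" for j
      using least[of j] that k by auto
    moreover have "{1..<k} \<subseteq> {1..K_max}"
      using k by auto
    ultimately show ?thesis
      using k cost[of "{1..<k}"] by blast
  next
    case False
    \<comment> \<open>The range includes \<open>K_max + 1\<close> in order to rule out the first
      alternative of \<open>infeas_le_delta_or_rho_large\<close>.\<close>
    then have small: "rho k \<le> rho_big" if "1 \<le> k" "k \<le> K_max + 1" for k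
      using that by force
    obtain k where k: "N \<le> k" "k \<le> K_max" "run.infeas k \<le> \<delta>"
      using run.infeas_le_delta_or_rho_large[of c_big \<delta> rho_big N] small[of "K_max + 1"]
        c_big c_big_pos \<delta>_pos rho_big N_pos
      by (auto simp: run.infeas_def K_max_def)
    then have "approx_KKT f h g l u \<epsilon> \<delta> (x k) (lam (k + 1)) (mu (k + 1))"
      using N_pos N by (intro run.approx_KKT_iterate) auto
    then show ?thesis
      using k N_pos small cost[of "{1..k}"] by (intro exI[of _ k]) auto
  qed
qed

end
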